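(* Let $(X,R)$ be a Yang-Baxter set. Then the homomorphisms $\partial_n:C_n^{\rm YB}(X)\to C_{n-1}^{\rm YB}(X)$ satisfy $\partial_{n-1}\circ\partial_n=0$ for all $n\ge 2$; that is, $(C_*^{\rm YB}(X),\partial_* )$ is a chain complex.
   Context: A Yang-Baxter set is a set $X$ with a map $R=(R_1,R_2):X\times X\to X\times X$ satisfying $(R\times 1)(1\times R)(R\times 1)=(1\times R)(R\times 1)(1\times R)$ on $X\times X\times X$, where $1$ is the identity map. $\mathcal I_n$ is the cube $[0,1]^n$ with its standard cubical structure. A face is obtained by letting some coordinates run over $I=[0,1]$ and fixing each of the others to be $0$ or $1$; edges are faces with exactly one free coordinate. Write $I_i$ for a free $i$-th coordinate, and $0_i,1_i$ for an $i$-th coordinate fixed at $0,1$. A Yang-Baxter coloring of $\mathcal I_n$ by $(X,R)$ is a map $L$ from the set of edges of $\mathcal I_n$ to $X$ such that for every $1\le i<j\le n$ and every choice of $\epsilon_k\in\{0,1\}$, $k\neq i,j$ (common to all four edges): if $L(\cdots I_i\cdots 0_j\cdots)=x$ and $L(\cdots 1_i\cdots I_j\cdots)=y$, then $L(\cdots 0_i\cdots I_j\cdots)=R_1(x,y)$ and $L(\cdots I_i\cdots 1_j\cdots)=R_2(x,y)$. For a face $\mathcal J$ with free coordinates $j_1<\dots<j_k$, its initial path is the sequence of edges $(f_1,\dots,f_k)$ of $\mathcal J$, where $f_p$ has free coordinate $j_p$, coordinates $j_1,\dots,j_{p-1}$ equal to $1$, coordinates $j_{p+1},\dots,j_k$ equal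 to $0$, and the remaining coordinates as in $\mathcal J$. For a coloring $L$ put $L(\mathcal J)=(L(f_1),\dots,L(f_k))\in X^k$ (the empty tuple if $k=0$). For each $(x_1,\dots,x_n)\in X^n$ there is exactly one Yang-Baxter coloring $L$ of $\mathcal I_n$ with $L(\mathcal I_n)=(x_1,\dots,x_n)$. $C_n^{\rm YB}(X)$ is the free abelian group on $X^n$ (so $C_0^{\rm YB}(X)=\mathbb Z$). The homomorphism $\partial_n$ is defined on a generator $(x_1,\dots,x_n)$, with $L$ the associated coloring, by $\partial_n(x_1,\dots,x_n)=\sum_{\mathcal J}\epsilon_{\mathcal J}L(\mathcal J)$, the sum over the $2n$ faces $\mathcal J$ of dimension $n-1$ of $\mathcal I_n$, where $\epsilon_{\mathcal J}=\pm1$ is the sign of $\mathcal J$ in the cubical boundary of $\mathcal I_n$ (inward normal placed last). Explicitly, $\epsilon_{\mathcal J}=(-1)^{n-i}$ if $\mathcal J$ is given by fixing the $i$-th coordinate to be $0$, and $\epsilon_{\mathcal J}=-(-1)^{n-i}$ if it is given by fixing the $i$-th coordinate to be $1$. For example $\partial_2(x,y)=(x)+(y)-(R_1(x,y))-(R_2(x,y))$. *)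

theory Defs
  imports "HOL-Algebra.Free_Abelian_Groups" "HOL-Library.FuncSet"
begin

definition R_times_id :: "('a \<times> 'a \<Rightarrow> 'a \<times> 'a) \<Rightarrow> 'a \<times> 'a \<times> 'a \<Rightarrow> 'a \<times> 'a \<times> 'a" where
  "R_times_id R = (\<lambda>(x, y, z). (fst (R (x, y)), snd (R (x, y)), z))"

definition id_times_R :: "('a \<times> 'a \<Rightarrow> 'a \<times> 'a) \<Rightarrow> 'a \<times> 'a \<times> 'a \<Rightarrow> 'a \<times> 'a \<times> 'a" where
  "id_times_R R = (\<lambda>(x, y, z). (x, R (y, z)))"

definition yang_baxter_set :: "'a set \<Rightarrow> ('a \<times> 'a \<Rightarrow> 'a \<times> 'a) \<Rightarrow> bool" where
  "yang_baxter_set X R \<longleftrightarrow>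
     R \<in> X \<times> X \<rightarrow> X \<times> X \<and>
     (\<forall>t \<in> X \<times> X \<times> X.
        (R_times_id R \<circ> id_times_R R \<circ> R_times_id R) t =
        (id_times_R R \<circ> R_times_id R \<circ> id_times_R R) t)"

text \<open>A face of the \<open>n\<close>-cube is a list of length \<open>n\<close> recording each coordinate; the coordinate
  numbered \<open>i\<close> in the usual count from \<open>1\<close> is the list entry with index \<open>i - 1\<close>.\<close>

datatype coord = Zero | One | Free

type_synonym face = "coord list"

definition free_coords :: "face \<Rightarrow> nat set" where
  "free_coords J = {i. i < length J \<and> J ! i = Free}"

definition faces :: "nat \<Rightarrow> nat \<Rightarrow> face set" where
  "faces n k = {J. length J = n \<and> card (free_coords J) = k}"

abbreviation edges :: "nat \<Rightarrow> face set" where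
  "edges n \<equiv> faces n 1"

definition full_face :: "nat \<Rightarrow> face" where
  "full_face n = replicate n Free"

definition facet :: "nat \<Rightarrow> nat \<Rightarrow> coord \<Rightarrow> face" where
  "facet n i e = (full_face n)[i := e]"

definition initial_edge :: "face \<Rightarrow> nat \<Rightarrow> face" where
  "initial_edge J p =
     map (\<lambda>q. if J ! q = Free then (if q < p then One else if q = p then Free else Zero) else J ! q)
       [0..<length J]"

definition initial_path :: "face \<Rightarrow> face list" where
  "initial_path J = map (initial_edge J) (sorted_list_of_set (free_coords J))"

text \<open>Colorings are extensional (\<open>undefined\<close> off the edges), so that two of them are equal as soon
  as they agree on edges.  The entries of \<open>J\<close> at \<open>i\<close> and \<open>j\<close> are always overwritten; only its
  remaining entries, which have to be \<open>Zero\<close> or \<open>One\<close>, matter.\<close>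

definition yb_coloring :: "nat \<Rightarrow> 'a set \<Rightarrow> ('a \<times> 'a \<Rightarrow> 'a \<times> 'a) \<Rightarrow> (face \<Rightarrow> 'a) \<Rightarrow> bool" where
  "yb_coloring n X R L \<longleftrightarrow>
     L \<in> edges n \<rightarrow>\<^sub>E X \<and>
     (\<forall>i j J. i < j \<longrightarrow> j < n \<longrightarrow> length J = n \<longrightarrow>
        (\<forall>k<n. k \<noteq> i \<longrightarrow> k \<noteq> j \<longrightarrow> J ! k \<in> {Zero, One}) \<longrightarrow>
        (\<forall>x y. L (J[i := Free, j := Zero]) = x \<longrightarrow> L (J[i := One, j := Free]) = y \<longrightarrow>
           L (J[i := Zero, j := Free]) = fst (R (x, y)) \<and>
           L (J[i := Free, j := One]) = snd (R (x, y))))"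

definition face_label :: "(face \<Rightarrow> 'a) \<Rightarrow> face \<Rightarrow> 'a list" where
  "face_label L J = map L (initial_path J)"

definition coloring_of :: "'a set \<Rightarrow> ('a \<times> 'a \<Rightarrow> 'a \<times> 'a) \<Rightarrow> 'a list \<Rightarrow> face \<Rightarrow> 'a" where
  "coloring_of X R xs =
     (THE L. yb_coloring (length xs) X R L \<and> face_label L (full_face (length xs)) = xs)"

definition yb_chains :: "'a set \<Rightarrow> nat \<Rightarrow> ('a list \<Rightarrow>\<^sub>0 int) monoid" where
  "yb_chains X n = free_Abelian_group {xs. length xs = n \<and> set xs \<subseteq> X}"

text \<open>With coordinates counted from \<open>0\<close>, the exponent \<open>n - i\<close> becomes \<open>n - Suc i\<close>.\<close>

definition facet_sign :: "nat \<Rightarrow> nat \<Rightarrow> coord \<Rightarrow> int" where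
  "facet_sign n i e = (if e = Zero then (- 1) ^ (n - Suc i) else - ((- 1) ^ (n - Suc i)))"

definition yb_boundary_gen ::
    "'a set \<Rightarrow> ('a \<times> 'a \<Rightarrow> 'a \<times> 'a) \<Rightarrow> nat \<Rightarrow> 'a list \<Rightarrow> 'a list \<Rightarrow>\<^sub>0 int" where
  "yb_boundary_gen X R n xs =
     (\<Sum>(i, e) \<in> {..<n} \<times> {Zero, One}.
        frag_cmul (facet_sign n i e) (frag_of (face_label (coloring_of X R xs) (facet n i e))))"

definition yb_boundary ::
    "'a set \<Rightarrow> ('a \<times> 'a \<Rightarrow> 'a \<times> 'a) \<Rightarrow> nat \<Rightarrow> ('a list \<Rightarrow>\<^sub>0 int) \<Rightarrow> ('a list \<Rightarrow>\<^sub>0 int)" where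
  "yb_boundary X R n = frag_extend (yb_boundary_gen X R n)"

end

theory Submission
  imports Defs
begin

text \<open>
  A coloring of the cube is determined by its initial path, and the sum defining the boundary runs
  over the restrictions of the coloring to the facets.  The restriction of a coloring to a facet is
  again a coloring (\<open>yb_coloring_facet_coloring\<close>), so by uniqueness it is the coloring associated with
  the label of the facet (\<open>coloring_of_facet_label\<close>).  Hence in the double boundary every term is the
  label of a codimension-two face under the one original coloring.  Each such face is reached through
  two facets, with opposite signs (\<open>facet_sign_swap\<close>), so the terms cancel as they do in the
  cellular chain complex of a cube (\<open>sum_cubical_pairs_eq_0\<close>).

  What remains is that every tuple is the initial path of exactly one coloring.  For existence, the
  labels are given by a formula that reads the coordinates of an edge from left to right.  A
  coordinate fixed at \<open>1\<close> means that the path has already walked that direction, so its label is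
  dropped; a coordinate fixed at \<open>0\<close> means that the direction is postponed to the very end of the path,
  so its label is pushed by \<open>R\<close> past all the later ones (\<open>sweep\<close>).  The square condition then follows
  by induction on the coordinates.  The Yang-Baxter equation enters twice: to interchange two sweeps
  (\<open>sweep_sweep\<close>), and to propagate a square across a coordinate fixed at \<open>1\<close>
  (\<open>first_label_square\<close>).  For uniqueness, the square condition expresses the label of any edge outside
  the initial path by the labels of two other edges that are smaller with respect to a suitable
  integer weight (\<open>edge_weight_square\<close>).
\<close>

section \<open>Consequences of the Yang-Baxter equation\<close>

lemma yb_closed:
  assumes "yang_baxter_set X R" "x \<in> X" "y \<in> X"
  shows "fst (R (x, y)) \<in> X" "snd (R (x, y)) \<in> X"
proof -
  have "R (x, y) \<in> X \<times> X"
    using assms by (auto simp: yang_baxter_set_def Pi_iff)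
  then show "fst (R (x, y)) \<in> X" "snd (R (x, y)) \<in> X"
    by auto
qed

lemma yb_braid:
  assumes "yang_baxter_set X R" "x \<in> X" "y \<in> X" "z \<in> X"
  shows "fst (R (x, fst (R (y, z)))) = fst (R (fst (R (x, y)), fst (R (snd (R (x, y)), z))))"
    and "R (snd (R (x, fst (R (y, z)))), snd (R (y, z))) =
      (snd (R (fst (R (x, y)), fst (R (snd (R (x, y)), z)))), snd (R (snd (R (x, y)), z)))"
proof -
  have "(R_times_id R \<circ> id_times_R R \<circ> R_times_id R) (x, y, z) =
        (id_times_R R \<circ> R_times_id R \<circ> id_times_R R) (x, y, z)"
    using assms by (auto simp: yang_baxter_set_def)
  then show "fst (R (x, fst (R (y, z)))) = fst (R (fst (R (x, y)), fst (R (snd (R (x, y)), z))))"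
    and "R (snd (R (x, fst (R (y, z)))), snd (R (y, z))) =
      (snd (R (fst (R (x, y)), fst (R (snd (R (x, y)), z)))), snd (R (snd (R (x, y)), z)))"
    by (auto simp: R_times_id_def id_times_R_def case_prod_unfold)
qed

text \<open>Replacing the label sequence \<open>x # ys\<close> of a monotone path by that of the path that walks the first
  direction last gives \<open>sweep R x ys\<close>, followed by one more label which is dropped: \<open>sweep R x ys\<close> is
  the label of the facet on which the first coordinate is \<open>0\<close>.\<close>

fun sweep :: "('a \<times> 'a \<Rightarrow> 'a \<times> 'a) \<Rightarrow> 'a \<Rightarrow> 'a list \<Rightarrow> 'a list" where
  "sweep R x [] = []"
| "sweep R x (y # ys) = fst (R (x, y)) # sweep R (snd (R (x, y))) ys"

lemma length_sweep [simp]: "length (sweep R x ys) = length ys"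
  by (induction ys arbitrary: x) auto

lemma set_sweep:
  assumes "yang_baxter_set X R" "x \<in> X" "set ys \<subseteq> X"
  shows "set (sweep R x ys) \<subseteq> X"
  using assms(2,3)
  by (induction ys arbitrary: x) (auto simp: yb_closed[OF assms(1)])

text \<open>Both sides label the face on which the first two coordinates are \<open>0\<close>; the two facets containing it
  are entered in opposite orders.  Passing each further label is one instance of the braid relation.\<close>

lemma sweep_sweep:
  assumes yb: "yang_baxter_set X R" and "x \<in> X" "y \<in> X" "set zs \<subseteq> X"
  shows "sweep R (fst (R (x, y))) (sweep R (snd (R (x, y))) zs) = sweep R x (sweep R y zs)"
  using assms(2-)
proof (induction zs arbitrary: x y)
  case (Cons z zs)
  define u v where "u = snd (R (x, fst (R (y, z))))" and "v = snd (R (y, z))"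
  have "u \<in> X" "v \<in> X"
    using Cons.prems by (auto simp: u_def v_def yb_closed[OF yb])
  then have "sweep R (fst (R (u, v))) (sweep R (snd (R (u, v))) zs) = sweep R u (sweep R v zs)"
    using Cons by auto
  moreover have "z \<in> X"
    using Cons.prems by auto
  ultimately show ?case
    using yb_braid[OF yb \<open>x \<in> X\<close> \<open>y \<in> X\<close> \<open>z \<in> X\<close>] by (simp add: u_def v_def)
qed simp

section \<open>A formula for the labels\<close>

text \<open>The label of an edge whose first coordinate is free, in the cube with initial path \<open>x # ys\<close>; the
  list argument holds the remaining coordinates of the edge.  A coordinate fixed at \<open>1\<close> forces its
  direction to be walked before the edge, which changes the label from \<open>x\<close> to the second component of
  \<open>R\<close>.\<close>

fun first_label :: "('a \<times> 'a \<Rightarrow> 'a \<times> 'a) \<Rightarrow> 'a \<Rightarrow> face \<Rightarrow> 'a list \<Rightarrow> 'a" where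
  "first_label R x (c # J) (y # ys) =
     (if c = One then first_label R (snd (R (x, y))) J ys else first_label R x J (sweep R y ys))"
| "first_label R x _ _ = x"

fun edge_label :: "('a \<times> 'a \<Rightarrow> 'a \<times> 'a) \<Rightarrow> face \<Rightarrow> 'a list \<Rightarrow> 'a" where
  "edge_label R (Zero # J) (x # xs) = edge_label R J (sweep R x xs)"
| "edge_label R (One # J) (x # xs) = edge_label R J xs"
| "edge_label R (Free # J) (x # xs) = first_label R x J xs"
| "edge_label R _ _ = undefined"

lemma first_label_in:
  assumes "yang_baxter_set X R" "x \<in> X" "set ys \<subseteq> X"
  shows "first_label R x J ys \<in> X"
  using assms(2,3)
proof (induction J arbitrary: x ys)
  case (Cons c J)
  then show ?case
    by (cases ys) (auto simp: yb_closed[OF assms(1)] set_sweep[OF assms(1)])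
qed simp

lemma edge_label_in:
  assumes "yang_baxter_set X R" "length xs = length J" "set xs \<subseteq> X" "Free \<in> set J"
  shows "edge_label R J xs \<in> X"
  using assms(2-)
proof (induction J arbitrary: xs)
  case (Cons c J)
  then obtain y ys where [simp]: "xs = y # ys"
    by (cases xs) auto
  show ?case
    using Cons
    by (cases c) (auto simp: first_label_in[OF assms(1)] set_sweep[OF assms(1)])
qed simp

text \<open>The square condition for the first two directions, whose labels on the initial path are \<open>x\<close> and \<open>y\<close>.
  Each further coordinate replaces \<open>x\<close>, \<open>y\<close> and \<open>zs\<close> by the labels on a facet.  At a coordinate fixed
  at \<open>1\<close> the new labels of the other two sides are as the square requires because of the second part
  of \<open>yb_braid\<close>; at one fixed at \<open>0\<close> this is \<open>sweep_sweep\<close>.\<close>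

lemma first_label_square:
  assumes yb: "yang_baxter_set X R" and "x \<in> X" "y \<in> X" "set zs \<subseteq> X"
    and "set C \<subseteq> {Zero, One}" "length zs = length C"
  shows "R (first_label R x C (sweep R y zs), first_label R y C zs) =
    (first_label R (fst (R (x, y))) C (sweep R (snd (R (x, y))) zs),
     first_label R (snd (R (x, y))) C zs)"
  using assms(2-)
proof (induction C arbitrary: x y zs)
  case (Cons c C)
  then obtain w ws where zs: "zs = w # ws"
    by (cases zs) auto
  have X: "x \<in> X" "y \<in> X" "w \<in> X" "set ws \<subseteq> X"
    using Cons.prems zs by auto
  show ?case
  proof (cases "c = One")
    case True
    have "snd (R (x, fst (R (y, w)))) \<in> X" "snd (R (y, w)) \<in> X"
      using X by (auto simp: yb_closed[OF yb])
    from Cons.IH[OF this X(4)] True show ?thesis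
      using Cons.prems yb_braid[OF yb X(1-3)] by (simp add: zs)
  next
    case False
    have "set (sweep R w ws) \<subseteq> X"
      using X by (simp add: set_sweep[OF yb])
    from Cons.IH[OF X(1,2) this] False show ?thesis
      using Cons.prems X by (simp add: zs sweep_sweep[OF yb] yb_closed[OF yb])
  qed
qed simp

text \<open>The square condition for the first direction and a later one.  The coordinates \<open>B\<close> in between are
  removed one at a time by passing to the facet that they determine, until \<open>first_label_square\<close> applies.\<close>

lemma edge_label_square_aux:
  assumes yb: "yang_baxter_set X R" and "x \<in> X" "set ys \<subseteq> X"
    and "set (B @ C) \<subseteq> {Zero, One}" "length ys = Suc (length (B @ C))"
  shows "R (first_label R x (B @ Zero # C) ys, edge_label R (B @ Free # C) ys) =
    (edge_label R (B @ Free # C) (sweep R x ys), first_label R x (B @ One # C) ys)"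
  using assms(2-)
proof (induction B arbitrary: x ys)
  case Nil
  then obtain z zs where "ys = z # zs"
    by (cases ys) auto
  then show ?case
    using Nil first_label_square[OF yb, of x z zs C] by simp
next
  case (Cons b B)
  then obtain z zs where ys: "ys = z # zs"
    by (cases ys) auto
  have X: "x \<in> X" "z \<in> X" "set zs \<subseteq> X"
    using Cons.prems ys by auto
  show ?case
  proof (cases "b = One")
    case True
    then show ?thesis
      using Cons X by (simp add: ys yb_closed[OF yb])
  next
    case False
    then have "b = Zero"
      using Cons.prems by auto
    then show ?thesis
      using Cons X by (simp add: ys set_sweep[OF yb] sweep_sweep[OF yb])
  qed
qed

lemma edge_label_square:
  assumes yb: "yang_baxter_set X R" and "set xs \<subseteq> X"
    and "set (A @ B @ C) \<subseteq> {Zero, One}" "length xs = Suc (Suc (length (A @ B @ C)))"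
  shows "R (edge_label R (A @ Free # B @ Zero # C) xs, edge_label R (A @ One # B @ Free # C) xs) =
    (edge_label R (A @ Zero # B @ Free # C) xs, edge_label R (A @ Free # B @ One # C) xs)"
  using assms(2-)
proof (induction A arbitrary: xs)
  case Nil
  then obtain y ys where "xs = y # ys"
    by (cases xs) auto
  then show ?case
    using Nil edge_label_square_aux[OF yb, of y ys B C] by simp
next
  case (Cons a A)
  then obtain y ys where xs: "xs = y # ys"
    by (cases xs) auto
  have "a = Zero \<or> a = One"
    using Cons.prems by auto
  then show ?case
    using Cons by (auto simp: xs set_sweep[OF yb])
qed

section \<open>Edges and squares of the cube\<close>

lemma edge_iff:
  "J \<in> edges n \<longleftrightarrow>
    length J = n \<and> (\<exists>A B. J = A @ Free # B \<and> set (A @ B) \<subseteq> {Zero, One})"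
proof
  assume J: "J \<in> edges n"
  then obtain p where p: "free_coords J = {p}"
    by (auto simp: faces_def card_1_singleton_iff)
  then have "p < length J" "J ! p = Free" and others: "\<And>k. k < length J \<Longrightarrow> J ! k = Free \<Longrightarrow> k = p"
    by (auto simp: free_coords_def)
  have "J = take p J @ Free # drop (Suc p) J"
    using id_take_nth_drop[OF \<open>p < length J\<close>] \<open>J ! p = Free\<close> by simp
  moreover have "c \<noteq> Free" if "c \<in> set (take p J)" for c
    using that others by (fastforce simp: in_set_conv_nth)
  moreover have "c \<noteq> Free" if c: "c \<in> set (drop (Suc p) J)" for c
  proof
    assume "c = Free"
    then obtain l where "l < length J - Suc p" "J ! (Suc p + l) = Free"
      using c by (auto simp: in_set_conv_nth)
    moreover from this have "Suc p + l < length J"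
      by linarith
    ultimately show False
      using others[of "Suc p + l"] by simp
  qed
  ultimately have "J = take p J @ Free # drop (Suc p) J \<and>
      set (take p J @ drop (Suc p) J) \<subseteq> {Zero, One}"
    by (auto, (metis coord.exhaust)+)
  then show "length J = n \<and> (\<exists>A B. J = A @ Free # B \<and> set (A @ B) \<subseteq> {Zero, One})"
    using J unfolding faces_def by blast
next
  assume "length J = n \<and> (\<exists>A B. J = A @ Free # B \<and> set (A @ B) \<subseteq> {Zero, One})"
  then obtain A B where J: "length J = n" "J = A @ Free # B" "set (A @ B) \<subseteq> {Zero, One}"
    by blast
  have "free_coords J = {length A}"
    unfolding free_coords_def J(2)
  proof (intro equalityI subsetI; clarsimp)
    fix i assume i: "i < Suc (length A + length B)" "(A @ Free # B) ! i = Free"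
    have "A ! i \<noteq> Free" if "i < length A"
      using J(3) nth_mem[OF that] by auto
    moreover have "B ! (i - Suc (length A)) \<noteq> Free" if "i > length A"
    proof -
      have "i - Suc (length A) < length B"
        using that i by linarith
      from nth_mem[OF this] show ?thesis
        using J(3) by auto
    qed
    ultimately show "i = length A"
      using i by (cases "i < length A"; cases "i = length A") (auto simp: nth_append nth_Cons')
  qed
  then show "J \<in> edges n"
    using J(1) by (simp add: faces_def)
qed

lemma edgeI:
  "set (A @ B) \<subseteq> {Zero, One} \<Longrightarrow> n = Suc (length (A @ B)) \<Longrightarrow> A @ Free # B \<in> edges n"
  unfolding edge_iff by auto

lemma square_edges:
  assumes "set (A @ B @ C) \<subseteq> {Zero, One}" "n = Suc (Suc (length (A @ B @ C)))" "c \<noteq> Free"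
  shows "A @ c # B @ Free # C \<in> edges n" "A @ Free # B @ c # C \<in> edges n"
proof -
  have c: "c \<in> {Zero, One}"
    using assms(3) by (cases c) auto
  then show "A @ c # B @ Free # C \<in> edges n"
    using edgeI[of "A @ c # B" C n] assms(1,2) by simp
  show "A @ Free # B @ c # C \<in> edges n"
    using edgeI[of A "B @ c # C" n] c assms(1,2) by simp
qed

text \<open>Splitting at the two free positions turns the index form of the square condition into one on
  concatenated lists, which suits induction on the coordinates.\<close>

lemma split_at_two:
  assumes "i < j" "j < length J" 
    and "\<forall>k<length J. k \<noteq> i \<longrightarrow> k \<noteq> j \<longrightarrow> J ! k \<in> {Zero, One}"
  obtains A B C where "length J = Suc (Suc (length (A @ B @ C)))" "set (A @ B @ C) \<subseteq> {Zero, One}"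
    "\<And>c d. J[i := c, j := d] = A @ c # B @ d # C"
proof
  define A B C where "A = take i J" and "B = take (j - Suc i) (drop (Suc i) J)" and "C = drop (Suc j) J"
  show "length J = Suc (Suc (length (A @ B @ C)))"
    using assms by (simp add: A_def B_def C_def)
  show "set (A @ B @ C) \<subseteq> {Zero, One}"
  proof
    fix c assume "c \<in> set (A @ B @ C)"
    then obtain k where "k < length J" "k \<noteq> i" "k \<noteq> j" "c = J ! k"
      using assms(1,2) unfolding A_def B_def C_def set_append Un_iff in_set_conv_nth
    proof (elim disjE exE conjE)
      fix l assume "l < length (take i J)" "take i J ! l = c"
      then show thesis using assms(1,2) by (intro that[of l]) auto
    next
      fix l assume "l < length (take (j - Suc i) (drop (Suc i) J))"
        "take (j - Suc i) (drop (Suc i) J) ! l = c"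
      then show thesis using assms(1,2) by (intro that[of "Suc i + l"]) auto
    next
      fix l assume "l < length (drop (Suc j) J)" "drop (Suc j) J ! l = c"
      then show thesis using assms(1,2) by (intro that[of "Suc j + l"]) auto
    qed
    then show "c \<in> {Zero, One}"
      using assms(3) by auto
  qed
  show "J[i := c, j := d] = A @ c # B @ d # C" for c d
    using assms
    by (intro nth_equalityI)
      (auto simp: A_def B_def C_def nth_append nth_Cons' nth_list_update min_def)
qed

lemma yb_coloring_square:
  assumes "yb_coloring n X R L" "set (A @ B @ C) \<subseteq> {Zero, One}" "n = Suc (Suc (length (A @ B @ C)))"
  shows "L (A @ Zero # B @ Free # C) = fst (R (L (A @ Free # B @ Zero # C), L (A @ One # B @ Free # C)))"
    and "L (A @ Free # B @ One # C) = snd (R (L (A @ Free # B @ Zero # C), L (A @ One # B @ Free # C)))"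
proof -
  define i j J where "i = length A" and "j = Suc (length A + length B)" and "J = A @ Zero # B @ Zero # C"
  have J: "J[i := c, j := d] = A @ c # B @ d # C" for c d
    by (simp add: i_def j_def J_def list_update_append)
  have len: "length J = n" "i < j" "j < n"
    using assms(3) by (auto simp: J_def i_def j_def)
  have "set J \<subseteq> {Zero, One}"
    using assms(2) by (auto simp: J_def)
  then have "\<forall>k<n. J ! k \<in> {Zero, One}"
    using len(1) nth_mem by blast
  then have "L (J[i := Zero, j := Free]) = fst (R (L (J[i := Free, j := Zero]), L (J[i := One, j := Free])))
     \<and> L (J[i := Free, j := One]) = snd (R (L (J[i := Free, j := Zero]), L (J[i := One, j := Free])))"
    using assms(1) len unfolding yb_coloring_def by blast
  then show "L (A @ Zero # B @ Free # C) = fst (R (L (A @ Free # B @ Zero # C), L (A @ One # B @ Free # C)))"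
    and "L (A @ Free # B @ One # C) = snd (R (L (A @ Free # B @ Zero # C), L (A @ One # B @ Free # C)))"
    unfolding J by auto
qed

lemma yb_coloring_edge_label:
  assumes yb: "yang_baxter_set X R" and xs: "set xs \<subseteq> X"
  shows "yb_coloring (length xs) X R (restrict (\<lambda>J. edge_label R J xs) (edges (length xs)))"
    (is "yb_coloring ?n X R ?L")
  unfolding yb_coloring_def
proof (intro conjI allI impI)
  show "?L \<in> edges ?n \<rightarrow>\<^sub>E X"
    using xs by (auto simp del: One_nat_def simp add: edge_iff intro!: edge_label_in[OF yb])
next
  fix i j J x y
  assume *: "i < j" "j < ?n" "length J = ?n"
    "\<forall>k<?n. k \<noteq> i \<longrightarrow> k \<noteq> j \<longrightarrow> J ! k \<in> {Zero, One}"
    "?L (J[i := Free, j := Zero]) = x" "?L (J[i := One, j := Free]) = y"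
  obtain A B C where ABC: "length J = Suc (Suc (length (A @ B @ C)))" "set (A @ B @ C) \<subseteq> {Zero, One}"
    and J: "\<And>c d. J[i := c, j := d] = A @ c # B @ d # C"
    using split_at_two[of i j J] * by metis
  have n: "?n = Suc (Suc (length (A @ B @ C)))"
    using ABC(1) * by simp
  have "R (x, y) = (?L (J[i := Zero, j := Free]), ?L (J[i := Free, j := One]))"
    using edge_label_square[OF yb xs ABC(2) n] *(5,6)
    by (simp only: J restrict_apply square_edges[OF ABC(2) n] if_True coord.simps not_False_eq_True)
  then show "?L (J[i := Zero, j := Free]) = fst (R (x, y))"
    "?L (J[i := Free, j := One]) = snd (R (x, y))"
    by auto
qed


section \<open>The coloring with a given initial path\<close>

text \<open>An edge is read as a number in base \<open>3\<close>.  Up to the free coordinate the digits of \<open>1\<close>, free and \<open>0\<close>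
  are \<open>0\<close>, \<open>1\<close> and \<open>2\<close>; after it \<open>0\<close> and \<open>1\<close> stand for themselves.  The order of the two fixed values
  is reversed at the free coordinate because an edge lies on the initial path exactly when it has only
  ones before its free coordinate and only zeros after it.\<close>

primrec weight_after :: "face \<Rightarrow> nat" where
  "weight_after [] = 0"
| "weight_after (c # J) = (if c = One then 3 ^ length J else 0) + weight_after J"

primrec edge_weight :: "face \<Rightarrow> nat" where
  "edge_weight [] = 0"
| "edge_weight (c # J) =
    (case c of One \<Rightarrow> edge_weight J | Free \<Rightarrow> 3 ^ length J + weight_after J
      | Zero \<Rightarrow> 2 * 3 ^ length J + edge_weight J)"

lemma weight_after_less: "weight_after J < 3 ^ length J"
  by (induction J) auto

lemma edge_weight_less: "edge_weight J < 3 ^ length J"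
proof (induction J)
  case (Cons c J)
  then show ?case
    using weight_after_less[of J] by (cases c) auto
qed simp

lemma edge_weight_append_mono:
  assumes "edge_weight J < edge_weight J'" "length J = length J'" "Free \<notin> set A"
  shows "edge_weight (A @ J) < edge_weight (A @ J')"
  using assms(3)
proof (induction A)
  case (Cons a A)
  then show ?case
    using assms(2) by (cases a) auto
qed (simp add: assms)

lemma weight_after_append_mono:
  "weight_after J < weight_after J' \<Longrightarrow> length J = length J' \<Longrightarrow>
    weight_after (A @ J) < weight_after (A @ J')"
  by (induction A) auto

text \<open>In each square, the two sides on the given path weigh less than the two sides whose labels are
  computed by \<open>R\<close>.\<close>

lemma edge_weight_square:
  assumes "set (A @ B @ C) \<subseteq> {Zero, One}"
  shows "edge_weight (A @ Free # B @ Zero # C) < edge_weight (A @ Zero # B @ Free # C)"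
    and "edge_weight (A @ One # B @ Free # C) < edge_weight (A @ Zero # B @ Free # C)"
    and "edge_weight (A @ Free # B @ Zero # C) < edge_weight (A @ Free # B @ One # C)"
    and "edge_weight (A @ One # B @ Free # C) < edge_weight (A @ Free # B @ One # C)"
proof -
  have "Free \<notin> set A"
    using assms by auto
  moreover have "weight_after (B @ Zero # C) < weight_after (B @ One # C)"
    by (rule weight_after_append_mono) auto
  ultimately show "edge_weight (A @ Free # B @ Zero # C) < edge_weight (A @ Zero # B @ Free # C)"
    and "edge_weight (A @ One # B @ Free # C) < edge_weight (A @ Zero # B @ Free # C)"
    and "edge_weight (A @ Free # B @ Zero # C) < edge_weight (A @ Free # B @ One # C)"
    and "edge_weight (A @ One # B @ Free # C) < edge_weight (A @ Free # B @ One # C)"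
    using weight_after_less[of "B @ Zero # C"] edge_weight_less[of "B @ Free # C"]
    by (auto intro!: edge_weight_append_mono)
qed

lemma initial_edge_full_face:
  assumes "p < n"
  shows "initial_edge (full_face n) p = replicate p One @ Free # replicate (n - Suc p) Zero"
  using assms
  by (intro nth_equalityI) (auto simp: initial_edge_def full_face_def nth_append nth_Cons')

lemma initial_path_full_face: "initial_path (full_face n) = map (initial_edge (full_face n)) [0..<n]"
proof -
  have "free_coords (full_face n) = {0..<n}"
    by (auto simp: free_coords_def full_face_def)
  then show ?thesis
    by (simp add: initial_path_def)
qed

text \<open>An edge off the initial path has a \<open>0\<close> before or a \<open>1\<close> after its free coordinate.  That coordinate and
  the free one span a square in which the edge is one of the two sides computed by \<open>R\<close>, so induction on
  the weight applies.\<close>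

lemma yb_coloring_eq_on_edges:
  assumes L: "yb_coloring n X R L" and L': "yb_coloring n X R L'"
    and init: "face_label L (full_face n) = face_label L' (full_face n)"
    and "J \<in> edges n"
  shows "L J = L' J"
  using assms(4)
proof (induction "edge_weight J" arbitrary: J rule: less_induct)
  case less
  obtain A B where J: "J = A @ Free # B" and AB: "set (A @ B) \<subseteq> {Zero, One}" and n: "length J = n"
    using less.prems unfolding edge_iff by blast
  consider "Zero \<in> set A" | "One \<in> set B" | "Zero \<notin> set A" "One \<notin> set B"
    by blast
  then show ?case
  proof cases
    case 1
    then obtain A1 A2 where A: "A = A1 @ Zero # A2"
      by (meson split_list)
    have A2B: "set (A1 @ A2 @ B) \<subseteq> {Zero, One}" "n = Suc (Suc (length (A1 @ A2 @ B)))"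
      using AB n by (auto simp: A J)
    have "L (A1 @ Free # A2 @ Zero # B) = L' (A1 @ Free # A2 @ Zero # B)"
      "L (A1 @ One # A2 @ Free # B) = L' (A1 @ One # A2 @ Free # B)"
      using edge_weight_square[OF A2B(1)] square_edges[OF A2B]
      by (auto intro!: less.hyps simp: J A simp del: One_nat_def)
    then show ?thesis
      using yb_coloring_square(1)[OF L A2B] yb_coloring_square(1)[OF L' A2B] by (simp add: J A)
  next
    case 2
    then obtain B1 B2 where B: "B = B1 @ One # B2"
      by (meson split_list)
    have AB12: "set (A @ B1 @ B2) \<subseteq> {Zero, One}" "n = Suc (Suc (length (A @ B1 @ B2)))"
      using AB n by (auto simp: B J)
    have "L (A @ Free # B1 @ Zero # B2) = L' (A @ Free # B1 @ Zero # B2)"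
      "L (A @ One # B1 @ Free # B2) = L' (A @ One # B1 @ Free # B2)"
      using edge_weight_square[OF AB12(1)] square_edges[OF AB12]
      by (auto intro!: less.hyps simp: J B simp del: One_nat_def)
    then show ?thesis
      using yb_coloring_square(2)[OF L AB12] yb_coloring_square(2)[OF L' AB12] by (simp add: J B)
  next
    case 3
    have "A = replicate (length A) One" "B = replicate (length B) Zero"
      using 3 AB by (auto simp: replicate_length_same[symmetric] intro!: replicate_eqI)
    moreover have "length A < n" "length B = n - Suc (length A)"
      using n J by auto
    ultimately have "J = initial_edge (full_face n) (length A)"
      by (simp add: initial_edge_full_face J)
    then show ?thesis
      using init \<open>length A < n\<close> by (auto simp: face_label_def initial_path_full_face)
  qed
qed

lemma first_label_replicate_Zero: "first_label R x (replicate k Zero) ys = x"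
proof (induction k arbitrary: ys)
  case (Suc k)
  then show ?case
    by (cases ys) auto
qed simp

lemma edge_label_initial:
  assumes "length xs = p + Suc k"
  shows "edge_label R (replicate p One @ Free # replicate k Zero) xs = xs ! p"
  using assms
proof (induction p arbitrary: xs)
  case 0
  then show ?case
    by (cases xs) (auto simp: first_label_replicate_Zero)
next
  case (Suc p)
  then show ?case
    by (cases xs) auto
qed

lemma ex1_yb_coloring:
  assumes yb: "yang_baxter_set X R" and xs: "set xs \<subseteq> X"
  shows "\<exists>!L. yb_coloring (length xs) X R L \<and> face_label L (full_face (length xs)) = xs"
proof (rule ex_ex1I)
  let ?n = "length xs"
  let ?L = "restrict (\<lambda>J. edge_label R J xs) (edges ?n)"
  have "?L (initial_edge (full_face ?n) p) = xs ! p" if "p < ?n" for p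
  proof -
    have "initial_edge (full_face ?n) p \<in> edges ?n"
      unfolding initial_edge_full_face[OF that]
      using that by (intro edgeI) auto
    then show ?thesis
      using that by (simp add: initial_edge_full_face edge_label_initial)
  qed
  then have "face_label ?L (full_face ?n) = xs"
    by (intro nth_equalityI) (simp_all only: face_label_def initial_path_full_face length_map length_upt nth_map nth_upt add_0 diff_zero)
  then show "\<exists>L. yb_coloring ?n X R L \<and> face_label L (full_face ?n) = xs"
    using yb_coloring_edge_label[OF yb xs] by blast
next
  fix L L'
  assume *: "yb_coloring (length xs) X R L \<and> face_label L (full_face (length xs)) = xs"
    "yb_coloring (length xs) X R L' \<and> face_label L' (full_face (length xs)) = xs"
  then have "L \<in> edges (length xs) \<rightarrow>\<^sub>E X" "L' \<in> edges (length xs) \<rightarrow>\<^sub>E X"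
    by (auto simp: yb_coloring_def)
  then show "L = L'"
    by (rule PiE_ext) (use * yb_coloring_eq_on_edges in metis)
qed

lemma coloring_of:
  assumes "yang_baxter_set X R" "set xs \<subseteq> X"
  shows "yb_coloring (length xs) X R (coloring_of X R xs)"
    and "face_label (coloring_of X R xs) (full_face (length xs)) = xs"
  using theI'[OF ex1_yb_coloring[OF assms]] by (auto simp: coloring_of_def)

lemma coloring_of_eqI:
  assumes "yang_baxter_set X R" "set xs \<subseteq> X"
    and "yb_coloring (length xs) X R L" "face_label L (full_face (length xs)) = xs"
  shows "coloring_of X R xs = L"
  unfolding coloring_of_def
  by (rule the1_equality[OF ex1_yb_coloring]) (use assms in auto)


section \<open>Restriction to a facet\<close>

text \<open>The embedding of a cube as the facet of the next cube that fixes coordinate \<open>i\<close> at \<open>e\<close>.  The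
  companion function \<open>skip i\<close> is the coface map on coordinate indices: the increasing injection
  that omits \<open>i\<close>.\<close>

definition insert_coord :: "nat \<Rightarrow> coord \<Rightarrow> face \<Rightarrow> face" where
  "insert_coord i e J = take i J @ e # drop i J"

definition skip :: "nat \<Rightarrow> nat \<Rightarrow> nat" where
  "skip i k = (if k < i then k else Suc k)"

lemma skip_less_iff [simp]: "skip i k < skip i l \<longleftrightarrow> k < l"
  by (auto simp: skip_def)

lemma skip_eq_iff [simp]: "skip i k = skip i l \<longleftrightarrow> k = l"
  by (auto simp: skip_def)

lemma skip_neq [simp]: "skip i k \<noteq> i" "i \<noteq> skip i k"
  by (auto simp: skip_def)

lemma skip_cases:
  assumes "k < Suc n" "i \<le> n"
  obtains "k = i" | l where "l < n" "k = skip i l"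
proof (cases k i rule: linorder_cases)
  case less
  then show thesis
    using assms that(2)[of k] by (simp add: skip_def)
next
  case greater
  then show thesis
    using assms that(2)[of "k - 1"] by (simp add: skip_def)
qed (use that in simp)

lemma length_insert_coord [simp]: "length (insert_coord i e J) = Suc (length J)"
  by (simp add: insert_coord_def)

lemma nth_insert_coord [simp]:
  assumes "i \<le> length J"
  shows "insert_coord i e J ! i = e"
    and "k < length J \<Longrightarrow> insert_coord i e J ! skip i k = J ! k"
  using assms by (auto simp: insert_coord_def skip_def nth_append min_def nth_Cons')

lemma skip_less_Suc [simp]: "k < n \<Longrightarrow> skip i k < Suc n"
  by (simp add: skip_def)

lemma insert_coord_eqI:
  assumes "length J' = Suc (length J)" "i \<le> length J" "J' ! i = e"
    and "\<And>k. k < length J \<Longrightarrow> J' ! skip i k = J ! k"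
  shows "insert_coord i e J = J'"
proof (rule nth_equalityI)
  fix k assume "k < length (insert_coord i e J)"
  then have "k < Suc (length J)" by simp
  then show "insert_coord i e J ! k = J' ! k"
    by (rule skip_cases[OF _ assms(2)]) (use assms in auto)
qed (simp add: assms)

lemma insert_coord_update:
  assumes "i \<le> length J" "k < length J"
  shows "insert_coord i e (J[k := c]) = (insert_coord i e J)[skip i k := c]"
  using assms by (intro insert_coord_eqI) (auto simp: nth_list_update)

text \<open>The cubical identity: a face of codimension two lies in exactly two facets.  The index shifts by one
  because the inner insertion counts coordinates within the facet.\<close>

lemma insert_coord_insert_coord:
  assumes "i \<le> j" "j \<le> length J"
  shows "insert_coord i e (insert_coord j f J) = insert_coord (Suc j) f (insert_coord i e J)"
  using assms by (auto simp: insert_coord_def min_def take_Cons' drop_Cons' Suc_diff_le drop_take)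

lemma free_coords_insert_coord:
  assumes "i \<le> length J" "e \<noteq> Free"
  shows "free_coords (insert_coord i e J) = skip i ` free_coords J"
proof (intro equalityI subsetI)
  fix k assume "k \<in> free_coords (insert_coord i e J)"
  then have k: "k < Suc (length J)" "insert_coord i e J ! k = Free"
    by (auto simp: free_coords_def)
  then show "k \<in> skip i ` free_coords J"
    by (elim skip_cases[OF _ assms(1)]) (use assms in \<open>auto simp: free_coords_def\<close>)
qed (use assms in \<open>auto simp: free_coords_def\<close>)

lemma insert_coord_in_faces:
  assumes "J \<in> faces n k" "i \<le> n" "e \<noteq> Free"
  shows "insert_coord i e J \<in> faces (Suc n) k"
  using assms by (auto simp: faces_def free_coords_insert_coord card_image inj_on_def)

lemma facet_eq: "i \<le> n \<Longrightarrow> facet (Suc n) i e = insert_coord i e (full_face n)"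
  by (rule sym, rule insert_coord_eqI) (auto simp: facet_def full_face_def simp del: replicate.simps)

lemma finite_free_coords: "finite (free_coords J)"
  by (simp add: free_coords_def)

lemma sorted_list_of_set_skip:
  assumes "finite A"
  shows "sorted_list_of_set (skip i ` A) = map (skip i) (sorted_list_of_set A)"
proof (rule sorted_distinct_set_unique)
  have "mono (skip i)"
    by (auto simp: mono_def skip_def)
  then show "sorted (map (skip i) (sorted_list_of_set A))"
    by (intro sorted_map_mono) (auto intro: mono_on_subset)
qed (use assms in \<open>auto simp: distinct_map inj_on_def\<close>)

lemma initial_edge_insert_coord:
  assumes "i \<le> length J" "e \<noteq> Free"
  shows "initial_edge (insert_coord i e J) (skip i p) = insert_coord i e (initial_edge J p)"
  using assms
  by (intro insert_coord_eqI[symmetric]) (auto simp: initial_edge_def simp del: upt_Suc)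

lemma initial_path_insert_coord:
  assumes "i \<le> length J" "e \<noteq> Free"
  shows "initial_path (insert_coord i e J) = map (insert_coord i e) (initial_path J)"
  using assms
  by (simp add: initial_path_def free_coords_insert_coord sorted_list_of_set_skip
      finite_free_coords initial_edge_insert_coord)

lemma initial_path_edges: "set (initial_path J) \<subseteq> edges (length J)"
proof -
  have "initial_edge J p \<in> edges (length J)" if "p \<in> free_coords J" for p
  proof -
    have "free_coords (initial_edge J p) = {p}"
      using that by (auto simp: free_coords_def initial_edge_def split: if_splits)
    then show ?thesis
      by (simp add: faces_def initial_edge_def)
  qed
  then show ?thesis
    by (auto simp: initial_path_def finite_free_coords)
qed

text \<open>Restricting to edges keeps colorings extensional, which is needed for equality with the result of
  \<open>coloring_of\<close>.\<close>

definition facet_coloring :: "nat \<Rightarrow> nat \<Rightarrow> coord \<Rightarrow> (face \<Rightarrow> 'a) \<Rightarrow> face \<Rightarrow> 'a" where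
  "facet_coloring n i e L = restrict (\<lambda>J. L (insert_coord i e J)) (edges n)"

lemma face_label_facet_coloring:
  assumes "i \<le> length J" "e \<noteq> Free"
  shows "face_label (facet_coloring (length J) i e L) J = face_label L (insert_coord i e J)"
  using initial_path_edges[of J] assms
  by (auto simp: face_label_def initial_path_insert_coord facet_coloring_def)

text \<open>The embedding of a facet preserves the order of the coordinates, so it sends squares to squares with
  the same roles of their sides.\<close>

lemma yb_coloring_facet_coloring:
  assumes L: "yb_coloring (Suc n) X R L" and i: "i \<le> n" and e: "e \<noteq> Free"
  shows "yb_coloring n X R (facet_coloring n i e L)"
    (is "yb_coloring n X R ?L")
  unfolding yb_coloring_def
proof (intro conjI allI impI)
  have "L \<in> edges (Suc n) \<rightarrow>\<^sub>E X"
    using L by (simp add: yb_coloring_def)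
  then show "?L \<in> edges n \<rightarrow>\<^sub>E X"
    using insert_coord_in_faces[OF _ i e] by (auto simp: facet_coloring_def)
next
  fix a b J x y
  assume *: "a < b" "b < n" "length J = n"
    "\<forall>k<n. k \<noteq> a \<longrightarrow> k \<noteq> b \<longrightarrow> J ! k \<in> {Zero, One}"
    "?L (J[a := Free, b := Zero]) = x" "?L (J[a := One, b := Free]) = y"
  obtain A B C where ABC: "length J = Suc (Suc (length (A @ B @ C)))" "set (A @ B @ C) \<subseteq> {Zero, One}"
    and J: "\<And>c d. J[a := c, b := d] = A @ c # B @ d # C"
    using split_at_two[of a b J] * by metis
  have n: "n = Suc (Suc (length (A @ B @ C)))"
    using ABC(1) * by simp
  have restr: "?L (J[a := c, b := Free]) = L ((insert_coord i e J)[skip i a := c, skip i b := Free])"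
    "?L (J[a := Free, b := c]) = L ((insert_coord i e J)[skip i a := Free, skip i b := c])"
    if "c \<noteq> Free" for c
    using square_edges[OF ABC(2) n that] i *(1-3) unfolding J[symmetric]
    by (simp_all add: facet_coloring_def insert_coord_update del: One_nat_def)
  have "skip i a < skip i b" "skip i b < Suc n" "length (insert_coord i e J) = Suc n"
    using * by auto
  moreover have "\<forall>k<Suc n. k \<noteq> skip i a \<longrightarrow> k \<noteq> skip i b \<longrightarrow> insert_coord i e J ! k \<in> {Zero, One}"
  proof (intro allI impI)
    fix k assume k: "k < Suc n" "k \<noteq> skip i a" "k \<noteq> skip i b"
    have "e \<in> {Zero, One}"
      using e by (cases e) auto
    with k(1) show "insert_coord i e J ! k \<in> {Zero, One}"
      by (elim skip_cases[OF _ i]) (use * i k in auto)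
  qed
  ultimately have "?L (J[a := Zero, b := Free]) = fst (R (x, y)) \<and>
      ?L (J[a := Free, b := One]) = snd (R (x, y))"
    using L *(5,6) unfolding yb_coloring_def by (simp add: restr)
  then show "?L (J[a := Zero, b := Free]) = fst (R (x, y))"
    "?L (J[a := Free, b := One]) = snd (R (x, y))"
    by auto
qed

lemma set_face_label:
  assumes "yb_coloring n X R L" "length J = n"
  shows "set (face_label L J) \<subseteq> X"
proof -
  have "L \<in> edges n \<rightarrow>\<^sub>E X"
    using assms(1) by (simp add: yb_coloring_def)
  then show ?thesis
    using initial_path_edges[of J] assms(2) by (auto simp: face_label_def)
qed

lemma length_full_face [simp]: "length (full_face n) = n"
  by (simp add: full_face_def)

lemma length_face_label_facet:
  assumes "i \<le> n" "e \<noteq> Free"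
  shows "length (face_label L (insert_coord i e (full_face n))) = n"
  using assms
  by (simp add: face_label_def initial_path_insert_coord initial_path_full_face)

lemma coloring_of_facet_label:
  assumes yb: "yang_baxter_set X R" and L: "yb_coloring (Suc n) X R L"
    and "i \<le> n" "e \<noteq> Free"
  shows "coloring_of X R (face_label L (insert_coord i e (full_face n))) = facet_coloring n i e L"
proof -
  let ?xs = "face_label L (insert_coord i e (full_face n))"
  have len: "length ?xs = n"
    using assms by (simp add: length_face_label_facet)
  show ?thesis
  proof (rule coloring_of_eqI[OF yb])
    show "set ?xs \<subseteq> X"
      using set_face_label[OF L] by simp
    show "yb_coloring (length ?xs) X R (facet_coloring n i e L)"
      using yb_coloring_facet_coloring[OF L] assms len by simp
    show "face_label (facet_coloring n i e L) (full_face (length ?xs)) = ?xs"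
      using face_label_facet_coloring[of i "full_face n" e L] assms unfolding len by simp
  qed
qed

section \<open>The boundary squares to zero\<close>

lemma yb_boundary_gen_eq:
  "yb_boundary_gen X R (Suc n) xs = (\<Sum>(i, e) \<in> {..n} \<times> {Zero, One}.
     frag_cmul (facet_sign (Suc n) i e)
       (frag_of (face_label (coloring_of X R xs) (insert_coord i e (full_face n)))))"
  unfolding yb_boundary_gen_def lessThan_Suc_atMost
  by (rule sum.cong) (auto simp: facet_eq)

lemma yb_boundary_gen_in_chains:
  assumes yb: "yang_baxter_set X R" and xs: "length xs = Suc n" "set xs \<subseteq> X"
  shows "yb_boundary_gen X R (Suc n) xs \<in> carrier (yb_chains X n)"
  unfolding yb_boundary_gen_eq yb_chains_def
proof (rule sum_closed_free_Abelian_group)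
  fix p assume "p \<in> {..n} \<times> {Zero, One}"
  then obtain i e where p: "p = (i, e)" and ie: "i \<le> n" "e \<noteq> Free"
    by auto
  have L: "yb_coloring (Suc n) X R (coloring_of X R xs)"
    using coloring_of[OF yb] xs by metis
  show "(case p of (i, e) \<Rightarrow> frag_cmul (facet_sign (Suc n) i e)
        (frag_of (face_label (coloring_of X R xs) (insert_coord i e (full_face n)))))
       \<in> carrier (free_Abelian_group {xs. length xs = n \<and> set xs \<subseteq> X})"
    unfolding p case_prod_conv using set_face_label[OF L, of "insert_coord i e (full_face n)"] length_face_label_facet[OF ie]
    by (auto dest!: subsetD[OF keys_cmul])
qed

lemma hom_yb_boundary:
  assumes "yang_baxter_set X R"
  shows "yb_boundary X R (Suc n) \<in> hom (yb_chains X (Suc n)) (yb_chains X n)"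
proof (rule homI)
  fix c assume "c \<in> carrier (yb_chains X (Suc n))"
  then have "Poly_Mapping.keys (yb_boundary_gen X R (Suc n) xs) \<subseteq> {xs. length xs = n \<and> set xs \<subseteq> X}"
    if "xs \<in> Poly_Mapping.keys c" for xs
    using yb_boundary_gen_in_chains[OF assms, of xs n] that by (auto simp: yb_chains_def)
  then show "yb_boundary X R (Suc n) c \<in> carrier (yb_chains X n)"
    using keys_frag_extend[of "yb_boundary_gen X R (Suc n)" c]
    unfolding yb_boundary_def yb_chains_def carrier_free_Abelian_group_iff by blast
qed (simp add: yb_chains_def yb_boundary_def frag_extend_add)

text \<open>The index pairs with \<open>i \<le> j\<close> and those with \<open>j < i\<close> are matched by
  \<open>((i, e), (j, f)) \<mapsto> ((Suc j, f), (i, e))\<close>, the matching of the two facets through a common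
  codimension-two face.\<close>

lemma sum_cubical_pairs_eq_0:
  fixes t :: "nat \<times> coord \<Rightarrow> nat \<times> coord \<Rightarrow> 'b::ab_group_add"
  assumes "\<And>i e j f. i \<le> j \<Longrightarrow> j \<le> n \<Longrightarrow> e \<in> E \<Longrightarrow> f \<in> E \<Longrightarrow> t (Suc j, f) (i, e) = - t (i, e) (j, f)"
    and "finite E"
  shows "(\<Sum>p \<in> {..Suc n} \<times> E. \<Sum>q \<in> {..n} \<times> E. t p q) = 0"
proof -
  let ?S = "({..Suc n} \<times> E) \<times> ({..n} \<times> E)"
  let ?A = "{(p, q) \<in> ?S. fst p \<le> fst q}" and ?B = "{(p, q) \<in> ?S. fst q < fst p}"
  have "(\<Sum>(p, q) \<in> ?B. t p q) = (\<Sum>(p, q) \<in> ?A. - t p q)"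
    by (rule sum.reindex_bij_witness[of _ "\<lambda>(p, q). ((Suc (fst q), snd q), p)"
          "\<lambda>(p, q). (q, (fst p - 1, snd p))"])
      (auto simp: assms(1)[symmetric])
  then have "(\<Sum>(p, q) \<in> ?A. t p q) + (\<Sum>(p, q) \<in> ?B. t p q) = 0"
    by (simp add: case_prod_unfold sum_negf)
  moreover have "(\<Sum>(p, q) \<in> ?S. t p q) = (\<Sum>(p, q) \<in> ?A. t p q) + (\<Sum>(p, q) \<in> ?B. t p q)"
  proof (subst sum.union_disjoint[symmetric])
    have "finite ?S"
      using assms(2) by simp
    then show "finite ?A" "finite ?B"
      by (auto elim: rev_finite_subset)
    show "sum (\<lambda>(p, q). t p q) ?S = sum (\<lambda>(p, q). t p q) (?A \<union> ?B)"
      by (rule sum.cong) auto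
  qed auto
  ultimately show ?thesis
    by (simp add: sum.cartesian_product)
qed

text \<open>Fixing coordinate \<open>Suc j\<close> first leaves coordinate \<open>i\<close> in place, whereas fixing \<open>i\<close> first lowers the
  other index to \<open>j\<close>: this shift by one makes the sign.\<close>

lemma facet_sign_swap:
  assumes "i \<le> j" "j \<le> n"
  shows "facet_sign (Suc (Suc n)) (Suc j) f * facet_sign (Suc n) i e =
    - (facet_sign (Suc (Suc n)) i e * facet_sign (Suc n) j f)"
  using assms by (auto simp: facet_sign_def Suc_diff_le)

lemma yb_boundary_boundary_gen:
  assumes yb: "yang_baxter_set X R" and xs: "length xs = Suc (Suc n)" "set xs \<subseteq> X"
  shows "yb_boundary X R (Suc n) (yb_boundary_gen X R (Suc (Suc n)) xs) = 0"
proof -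
  define L where "L = coloring_of X R xs"
  have L: "yb_coloring (Suc (Suc n)) X R L"
    using coloring_of[OF yb] xs L_def by metis
  define t where "t = (\<lambda>(i, e) (j, f).
    frag_cmul (facet_sign (Suc (Suc n)) i e * facet_sign (Suc n) j f)
      (frag_of (face_label L (insert_coord i e (insert_coord j f (full_face n))))))"
  have "yb_boundary X R (Suc n) (yb_boundary_gen X R (Suc (Suc n)) xs) =
    (\<Sum>(i, e) \<in> {..Suc n} \<times> {Zero, One}. frag_cmul (facet_sign (Suc (Suc n)) i e)
       (yb_boundary_gen X R (Suc n) (face_label L (insert_coord i e (full_face (Suc n))))))"
    by (simp add: yb_boundary_def yb_boundary_gen_eq[of X R "Suc n"] frag_extend_sum L_def o_def
        case_prod_unfold frag_extend_cmul)
  also have "\<dots> = (\<Sum>p \<in> {..Suc n} \<times> {Zero, One}. \<Sum>q \<in> {..n} \<times> {Zero, One}. t p q)"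
  proof (rule sum.cong[OF refl])
    fix p assume "p \<in> {..Suc n} \<times> {Zero, One}"
    then obtain i e where p: "p = (i, e)" and ie: "i \<le> Suc n" "e \<noteq> Free"
      by auto
    have "face_label (facet_coloring (Suc n) i e L) (insert_coord j f (full_face n)) =
        face_label L (insert_coord i e (insert_coord j f (full_face n)))" for j f
      using face_label_facet_coloring[of i "insert_coord j f (full_face n)" e L] ie by simp
    then show "(case p of (i, e) \<Rightarrow> frag_cmul (facet_sign (Suc (Suc n)) i e)
        (yb_boundary_gen X R (Suc n) (face_label L (insert_coord i e (full_face (Suc n)))))) =
      (\<Sum>q \<in> {..n} \<times> {Zero, One}. t p q)"
      unfolding p case_prod_conv
      by (simp add: yb_boundary_gen_eq coloring_of_facet_label[OF yb L ie] frag_cmul_sum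
          case_prod_unfold t_def)
  qed
  also have "\<dots> = 0"
  proof (rule sum_cubical_pairs_eq_0)
    fix i e j f assume "i \<le> j" "j \<le> n"
    then show "t (Suc j, f) (i, e) = - t (i, e) (j, f)"
      by (simp add: t_def facet_sign_swap insert_coord_insert_coord)
  qed simp
  finally show ?thesis .
qed

theorem mainTheorem2:
  fixes X :: "'a set" and R :: "'a \<times> 'a \<Rightarrow> 'a \<times> 'a"
  assumes "yang_baxter_set X R"
  shows "(\<forall>n\<ge>1. yb_boundary X R n \<in> hom (yb_chains X n) (yb_chains X (n - 1))) \<and>
         (\<forall>n\<ge>2. \<forall>c \<in> carrier (yb_chains X n).
            (yb_boundary X R (n - 1) \<circ> yb_boundary X R n) c = \<one>\<^bsub>yb_chains X (n - 2)\<^esub>)"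
proof (intro conjI allI impI ballI)
  fix n :: nat assume "n \<ge> 1"
  then show "yb_boundary X R n \<in> hom (yb_chains X n) (yb_chains X (n - 1))"
    using hom_yb_boundary[OF assms, of "n - 1"] by simp
next
  fix n :: nat and c assume "n \<ge> 2" and c: "c \<in> carrier (yb_chains X n)"
  then obtain m where n: "n = Suc (Suc m)"
    by (metis add_2_eq_Suc le_Suc_ex)
  from c have "Poly_Mapping.keys c \<subseteq> {xs. length xs = n \<and> set xs \<subseteq> X}"
    by (simp add: yb_chains_def)
  then have "yb_boundary X R (Suc m) (yb_boundary X R n c) = 0"
  proof (rule free_Abelian_group_induct)
    fix xs assume "xs \<in> {xs. length xs = n \<and> set xs \<subseteq> X}"
    then show "yb_boundary X R (Suc m) (yb_boundary X R n (frag_of xs)) = 0"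
      using yb_boundary_boundary_gen[OF assms, of xs m] by (simp add: n yb_boundary_def)
  qed (simp_all add: yb_boundary_def frag_extend_diff)
  then show "(yb_boundary X R (n - 1) \<circ> yb_boundary X R n) c = \<one>\<^bsub>yb_chains X (n - 2)\<^esub>"
    by (simp add: n yb_chains_def)
qed

end
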